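(* Let $F$ be a non-Archimedean local field of characteristic zero and let $K/F$ be a quadratic wildly ramified extension, with ramification break $t$. Let $\omega_{K/F}$ be the quadratic character of $F^\times$ attached to $K/F$ by local class field theory. Then: (i) the conductor of $\omega_{K/F}$ is $a(\omega_{K/F})=t+1$; (ii) if $\chi$ is a symplectic type character of $K^\times$ with conductor $m=a(\chi)$, then $m=2t+1$ when $m$ is odd, and $m\ge 2(t+1)$ when $m$ is even.
   Context: For a non-Archimedean local field $E$: $O_E$ is its ring of integers, $P_E$ the maximal ideal, $\nu_E$ the normalized valuation, $U_E=O_E^\times$, $U_E^0=U_E$ and $U_E^i=1+P_E^i$ for $i\ge1$. The conductor $a(\chi)$ of a character $\chi:E^\times\to\mathbb{C}^\times$ is the smallest integer $i\ge 0$ such that $\chi$ is trivial on $U_E^i$. The extension $K/F$ is wildly ramified if the residue characteristic divides $[K:F]=2$ (so the residue characteristic is $2$). For $G=\mathrm{Gal}(K/F)$ the lower ramification groups are $G_i=\{\sigma\in G:\nu_K(\sigma(\alpha)-\alpha)\ge i+1 \ \forall \alpha\in O_K\}$; for quadratic $K/F$ the ramification break is the unique integer $t$ with $G_t=G$ and $G_{t+1}=\{1\}$ (in the wild case $t\ge1$). $\omega_{K/F}$ is the unique nontrivial character of $F^\times$ trivial on $N_{K/F}(K^\times)$. A character $\chi$ of $K^\times$ is of symplectic type if $\chi|_{F^\times}=\omega_{K/F}$. *)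

theory Defs
  imports Complex_Main
begin

text \<open>A normalized discrete valuation on a field (the value at 0, i.e. infinity,
  is never used: all clauses are guarded by nonzeroness).\<close>
definition discrete_val :: "('k::field \<Rightarrow> int) \<Rightarrow> bool" where
  "discrete_val v \<longleftrightarrow>
     (\<forall>x y. x \<noteq> 0 \<longrightarrow> y \<noteq> 0 \<longrightarrow> v (x * y) = v x + v y) \<and>
     (\<forall>x y. x \<noteq> 0 \<longrightarrow> y \<noteq> 0 \<longrightarrow> x + y \<noteq> 0 \<longrightarrow> min (v x) (v y) \<le> v (x + y)) \<and>
     (\<forall>n. \<exists>x. x \<noteq> 0 \<and> v x = n)"

definition val_ring :: "('k::field \<Rightarrow> int) \<Rightarrow> 'k set" where
  "val_ring v = {x. x = 0 \<or> 0 \<le> v x}"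

definition val_complete :: "('k::field \<Rightarrow> int) \<Rightarrow> bool" where
  "val_complete v \<longleftrightarrow>
     (\<forall>X :: nat \<Rightarrow> 'k.
        (\<forall>k. \<exists>N. \<forall>m\<ge>N. \<forall>n\<ge>N. X m \<noteq> X n \<longrightarrow> k \<le> v (X m - X n)) \<longrightarrow>
        (\<exists>L. \<forall>k. \<exists>N. \<forall>n\<ge>N. X n \<noteq> L \<longrightarrow> k \<le> v (X n - L)))"

definition finite_residue :: "('k::field \<Rightarrow> int) \<Rightarrow> bool" where
  "finite_residue v \<longleftrightarrow>
     (\<exists>R. finite R \<and> R \<subseteq> val_ring v \<and>
        (\<forall>x\<in>val_ring v. \<exists>r\<in>R. x = r \<or> 1 \<le> v (x - r)))"

definition local_field :: "('k::field \<Rightarrow> int) \<Rightarrow> bool" where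
  "local_field v \<longleftrightarrow> discrete_val v \<and> val_complete v \<and> finite_residue v"

definition field_aut :: "('k::field \<Rightarrow> 'k) \<Rightarrow> bool" where
  "field_aut s \<longleftrightarrow> bij s \<and> s 1 = 1 \<and>
     (\<forall>x y. s (x + y) = s x + s y) \<and> (\<forall>x y. s (x * y) = s x * s y)"

definition fixed_field :: "('k \<Rightarrow> 'k) \<Rightarrow> 'k set" where
  "fixed_field s = {x. s x = x}"

text \<open>Unit filtration U^i of the field S (a subset of the ambient type) with
  normalized valuation w: U^0 = units, U^i = 1 + P^i.\<close>
definition unit_filt :: "'k::field set \<Rightarrow> ('k \<Rightarrow> int) \<Rightarrow> nat \<Rightarrow> 'k set" where
  "unit_filt S w i =
     (if i = 0 then {x\<in>S. x \<noteq> 0 \<and> w x = 0}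
      else {x\<in>S. x = 1 \<or> (x \<noteq> 1 \<and> int i \<le> w (x - 1))})"

definition is_char :: "'k::field set \<Rightarrow> ('k \<Rightarrow> int) \<Rightarrow> ('k \<Rightarrow> complex) \<Rightarrow> bool" where
  "is_char S w c \<longleftrightarrow>
     (\<forall>x\<in>S. x \<noteq> 0 \<longrightarrow> c x \<noteq> 0) \<and>
     (\<forall>x\<in>S. \<forall>y\<in>S. x \<noteq> 0 \<longrightarrow> y \<noteq> 0 \<longrightarrow> c (x * y) = c x * c y) \<and>
     (\<exists>i. \<forall>x\<in>unit_filt S w i. c x = 1)"

definition conductor :: "'k::field set \<Rightarrow> ('k \<Rightarrow> int) \<Rightarrow> ('k \<Rightarrow> complex) \<Rightarrow> nat" where
  "conductor S w c = (LEAST i. \<forall>x\<in>unit_filt S w i. c x = 1)"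

definition in_ram_group :: "('k::field \<Rightarrow> 'k) \<Rightarrow> ('k \<Rightarrow> int) \<Rightarrow> int \<Rightarrow> bool" where
  "in_ram_group s v i \<longleftrightarrow>
     (\<forall>a\<in>val_ring v. s a \<noteq> a \<longrightarrow> i + 1 \<le> v (s a - a))"

definition ram_break :: "('k::field \<Rightarrow> 'k) \<Rightarrow> ('k \<Rightarrow> int) \<Rightarrow> int" where
  "ram_break s v = (THE t. in_ram_group s v t \<and> \<not> in_ram_group s v (t + 1))"

end

theory Submission
  imports Defs
begin

text \<open>
  Let \<open>\<pi>\<close> be a uniformizer of \<open>K\<close>. Since \<open>K/F\<close> is ramified, \<open>v\<close> is even on \<open>F\<close>, and
  \<open>v (a + b \<pi>) = min (v a) (v b + 1)\<close> for \<open>a, b\<close> in \<open>F\<close>; hence \<open>t + 1 = v (s \<pi> - \<pi>)\<close> and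
  \<open>v (s x - x) \<ge> v x + t\<close> for every \<open>x\<close>. In \<open>N (1 + x) = 1 + Tr x + N x\<close> the norm term
  dominates below the break and the trace term dominates above it: for \<open>i < t\<close> one solves
  \<open>N x \<equiv> y\<close> using that squaring is bijective on the finite residue field of characteristic 2, and
  for \<open>i > t\<close> one takes \<open>x = y \<theta>\<close> with \<open>Tr \<theta> = 1\<close> and \<open>v \<theta> = - t\<close>. So
  \<open>U\<^sub>F\<^sup>i \<subseteq> N K\<^sup>\<times> U\<^sub>F\<^sup>i\<^sup>+\<^sup>1\<close> for all \<open>i \<noteq> t\<close>. As \<open>\<omega>\<close> is trivial on norms and on some
  \<open>U\<^sub>F\<^sup>j\<close>, it is trivial on \<open>U\<^sub>F\<^sup>t\<^sup>+\<^sup>1\<close>; if it were trivial on \<open>U\<^sub>F\<^sup>t\<close>, it would be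
  trivial on \<open>U\<^sub>F\<close>, hence on \<open>F\<^sup>\<times>\<close>. For the second part,
  \<open>U\<^sub>F\<^sup>t \<subseteq> U\<^sub>K\<^sup>2\<^sup>t\<close> forces \<open>a(\<chi>) > 2t\<close>, and \<open>U\<^sub>K\<^sup>2\<^sup>n = U\<^sub>F\<^sup>n U\<^sub>K\<^sup>2\<^sup>n\<^sup>+\<^sup>1\<close> rules out
  \<open>a(\<chi>) = 2n + 1\<close> for \<open>n > t\<close>.
\<close>

text \<open>Zero is put in by hand because \<open>v 0\<close> is unspecified. The index is an
  integer so that elements of negative valuation are covered.\<close>

definition frac_ideal :: "('k::field \<Rightarrow> int) \<Rightarrow> int \<Rightarrow> 'k set" where
  "frac_ideal v n = {x. x = 0 \<or> n \<le> v x}"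

section \<open>Ideals, units and residues of a discrete valuation\<close>

locale discrete_valuation =
  fixes v :: "'k::field \<Rightarrow> int"
  assumes discrete_val: "discrete_val v"
begin

abbreviation P :: "int \<Rightarrow> 'k set" where "P \<equiv> frac_ideal v"

lemma val_mult: "x \<noteq> 0 \<Longrightarrow> y \<noteq> 0 \<Longrightarrow> v (x * y) = v x + v y"
  using discrete_val unfolding discrete_val_def by blast

lemma val_add: "x \<noteq> 0 \<Longrightarrow> y \<noteq> 0 \<Longrightarrow> x + y \<noteq> 0 \<Longrightarrow> min (v x) (v y) \<le> v (x + y)"
  using discrete_val unfolding discrete_val_def by blast

lemma val_one [simp]: "v 1 = 0"
  using val_mult[of 1 1] by simp

lemma val_minus [simp]: "v (- x) = v x"
proof (cases "x = 0")
  case False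
  have "v (- 1) + v (- 1) = v 1" using val_mult[of "- 1" "- 1"] by simp
  then show ?thesis using val_mult[of "- 1" x] False by simp
qed simp

lemma val_power: "x \<noteq> 0 \<Longrightarrow> v (x ^ n) = int n * v x"
  by (induction n) (auto simp: val_mult algebra_simps)

lemma val_divide: "x \<noteq> 0 \<Longrightarrow> y \<noteq> 0 \<Longrightarrow> v (x / y) = v x - v y"
  using val_mult[of "x / y" y] by simp

lemma zero_in_P [simp]: "0 \<in> P n"
  by (simp add: frac_ideal_def)

lemma P_iff: "x \<noteq> 0 \<Longrightarrow> x \<in> P n \<longleftrightarrow> n \<le> v x"
  by (simp add: frac_ideal_def)

lemma P_mono: "x \<in> P m \<Longrightarrow> n \<le> m \<Longrightarrow> x \<in> P n"
  by (auto simp: frac_ideal_def)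

lemma P_add: "x \<in> P n \<Longrightarrow> y \<in> P n \<Longrightarrow> x + y \<in> P n"
  using val_add[of x y] unfolding frac_ideal_def
  by (cases "x = 0 \<or> y = 0 \<or> x + y = 0") auto

lemma P_minus: "x \<in> P n \<Longrightarrow> - x \<in> P n"
  by (auto simp: frac_ideal_def)

lemma P_diff: "x \<in> P n \<Longrightarrow> y \<in> P n \<Longrightarrow> x - y \<in> P n"
  using P_add[of x n "- y"] P_minus by simp

lemma P_mult: "x \<in> P m \<Longrightarrow> y \<in> P n \<Longrightarrow> x * y \<in> P (m + n)"
  by (cases "x = 0 \<or> y = 0") (auto simp: frac_ideal_def val_mult)

lemma val_add_eq_left:
  assumes "x \<noteq> 0" "y \<in> P (v x + 1)"
  shows "x + y \<noteq> 0 \<and> v (x + y) = v x"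
proof -
  have not_in: "x \<notin> P (v x + 1)" using assms(1) by (simp add: P_iff)
  have sum: "x + y \<notin> P (v x + 1)" using P_diff[of "x + y" _ y] assms(2) not_in by auto
  then have nz: "x + y \<noteq> 0" by auto
  have "x + y \<in> P (v x)"
    using P_add[of x "v x" y] P_mono[OF assms(2), of "v x"] assms(1) by (simp add: P_iff)
  then show ?thesis using sum nz by (simp add: P_iff)
qed

abbreviation "units \<equiv> {x. x \<noteq> 0 \<and> v x = 0}"

lemma one_plus_unit: "x \<in> P 1 \<Longrightarrow> 1 + x \<in> units"
  using val_add_eq_left[of 1 x] by simp

lemma unit_quotient:
  assumes "x \<in> units" "y \<in> units" "x - y \<in> P n"
  shows "x / y \<in> units" "x / y - 1 \<in> P n"
proof -
  show "x / y \<in> units" using assms by (simp add: val_divide)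
  have "x / y - 1 = (x - y) / y" using assms(2) by (simp add: field_simps)
  also have "\<dots> \<in> P n"
    using assms(2,3) by (cases "x - y = 0") (auto simp: P_iff val_divide)
  finally show "x / y - 1 \<in> P n" .
qed

lemma unit_filt_UNIV: "unit_filt UNIV v i = {x \<in> units. x - 1 \<in> P (int i)}"
proof (cases i)
  case 0
  then show ?thesis
    using P_diff[of _ 0 1] by (auto simp: unit_filt_def P_iff)
next
  case (Suc n)
  have "x \<in> units" if "x - 1 \<in> P (int i)" for x
    using one_plus_unit[of "x - 1"] P_mono[OF that, of 1] Suc by simp
  then show ?thesis using Suc by (auto simp: unit_filt_def P_iff)
qed

text \<open>Pigeonhole on \<open>x ^ 2 ^ n\<close>; injectivity of the Frobenius map then cancels common
  exponents. The witness is a power of \<open>x\<close>, so it stays in every subfield containing \<open>x\<close>.\<close>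
lemma residue_square_root:
  assumes fin: "finite_residue v" and two: "2 \<in> P 1" and x: "x \<in> units"
  shows "\<exists>n. x - (x ^ n)\<^sup>2 \<in> P 1"
proof -
  obtain R where R: "finite R" "\<forall>x\<in>val_ring v. \<exists>r\<in>R. x = r \<or> 1 \<le> v (x - r)"
    using fin unfolding finite_residue_def by blast
  have pow: "x ^ n \<in> units" for n using x by (simp add: val_power)
  then have "\<forall>n. \<exists>r\<in>R. x ^ n - r \<in> P 1"
    using R(2) by (fastforce simp: val_ring_def frac_ideal_def)
  then obtain f where f: "\<And>n. f n \<in> R" "\<And>n. x ^ n - f n \<in> P 1" by metis
  have "\<not> inj (\<lambda>n. f (2 ^ n))"
    using R(1) f(1) finite_subset[of "range (\<lambda>n. f (2 ^ n))" R] finite_imageD[of "\<lambda>n. f (2 ^ n)" UNIV]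
    by (auto simp: image_subset_iff)
  then obtain i j where "i < j" "f (2 ^ i) = f (2 ^ j)"
    unfolding inj_def by (metis linorder_neqE_nat)
  then obtain k where "f (2 ^ i) = f (2 ^ (i + Suc k))"
    by (metis less_iff_Suc_add add_Suc_right)
  then have *: "x ^ 2 ^ i - x ^ 2 ^ (i + Suc k) \<in> P 1"
    using P_diff[OF f(2)[of "2 ^ i"] f(2)[of "2 ^ (i + Suc k)"]] by simp
  have frob: "a - b \<in> P 1" if "a\<^sup>2 - b\<^sup>2 \<in> P 1" "a \<in> units" "b \<in> units" for a b
  proof -
    have "b * (a - b) \<in> P 0"
      using that P_mult[of b 0 "a - b" 0] P_diff[of a 0 b] by (simp add: P_iff)
    then have "2 * (b * (a - b)) \<in> P 1" using P_mult[OF two, of _ 0] by simp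
    then have "(a\<^sup>2 - b\<^sup>2) - 2 * (b * (a - b)) \<in> P 1" using that(1) P_diff by blast
    moreover have "(a\<^sup>2 - b\<^sup>2) - 2 * (b * (a - b)) = (a - b)\<^sup>2"
      by (simp add: power2_eq_square algebra_simps)
    ultimately show ?thesis
      by (cases "a - b = 0") (auto simp: P_iff val_power)
  qed
  have "x - x ^ 2 ^ Suc k \<in> P 1"
    using *
  proof (induction i)
    case (Suc i)
    have "(x ^ 2 ^ i)\<^sup>2 - (x ^ 2 ^ (i + Suc k))\<^sup>2 \<in> P 1"
      using Suc.prems by (simp add: power_mult[symmetric] mult.commute)
    then show ?case using frob pow Suc.IH by blast
  qed simp
  then have "x - (x ^ 2 ^ k)\<^sup>2 \<in> P 1"
    by (simp add: power_mult[symmetric] mult.commute)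
  then show ?thesis by blast
qed

end

section \<open>Galois action on a ramified quadratic extension\<close>

locale ramified_quadratic = discrete_valuation v
  for v :: "'k::field \<Rightarrow> int" +
  fixes s :: "'k \<Rightarrow> 'k" and \<pi> :: 'k
  assumes aut: "field_aut s" and invol: "s (s x) = x"
    and fixed_even: "x \<noteq> 0 \<Longrightarrow> s x = x \<Longrightarrow> even (v x)"
    and unif_nz: "\<pi> \<noteq> 0" and val_unif: "v \<pi> = 1"
begin

abbreviation F :: "'k set" where "F \<equiv> fixed_field s"

abbreviation Nm :: "'k \<Rightarrow> 'k" where "Nm x \<equiv> x * s x"

text \<open>The break is read off at the uniformizer alone; \<open>ram_break_eq\<close> matches it
  with the ramification groups.\<close>

definition break :: int where "break = v (s \<pi> - \<pi>) - 1"

lemma s_add [simp]: "s (x + y) = s x + s y"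
  and s_mult [simp]: "s (x * y) = s x * s y"
  and s_one [simp]: "s 1 = 1"
  using aut unfolding field_aut_def by auto

lemma s_zero [simp]: "s 0 = 0"
  using s_add[of 0 0] by (metis add_0_right add_cancel_left_right)

lemma s_minus [simp]: "s (- x) = - s x"
  using s_add[of x "- x"] by (simp del: s_add add: eq_neg_iff_add_eq_0 add.commute)

lemma s_diff [simp]: "s (x - y) = s x - s y"
  using s_add[of x "- y"] by (simp del: s_add)

lemma s_eq_0 [simp]: "s x = 0 \<longleftrightarrow> x = 0"
  using invol[of x] by auto

lemma s_divide [simp]: "s (x / y) = s x / s y"
proof (cases "y = 0")
  case False
  then have "s (x / y) * s y = s x" by (simp flip: s_mult)
  then show ?thesis using False by (simp add: field_simps)
qed simp

lemma s_power [simp]: "s (x ^ n) = s x ^ n"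
  by (induction n) auto

declare invol [simp]

lemma F_iff: "x \<in> F \<longleftrightarrow> s x = x"
  by (simp add: fixed_field_def)

text \<open>Valuations on \<open>F\<close> are even, so an odd bound improves by one. This
  repeatedly gains the last step of a congruence.\<close>

lemma F_P_even:
  assumes "x \<in> F" "x \<in> P (2 * n - 1)"
  shows "x \<in> P (2 * n)"
proof (cases "x = 0")
  case False
  then have "even (v x)" "2 * n - 1 \<le> v x"
    using assms fixed_even by (auto simp: F_iff P_iff)
  then have "2 * n \<le> v x" by presburger
  then show ?thesis using False by (simp add: P_iff)
qed simp

text \<open>If \<open>v x \<noteq> v (s x)\<close>, then the trace of \<open>x\<close> has valuation \<open>min (v x) (v (s x))\<close>; as trace
  and norm have even valuation, both \<open>v x\<close> and \<open>v (s x)\<close> are even.\<close>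
lemma val_s_odd:
  assumes "x \<noteq> 0" "odd (v x)"
  shows "v (s x) = v x"
proof (rule ccontr)
  assume ne: "v (s x) \<noteq> v x"
  have "even (v (x * s x))"
    using assms fixed_even[of "x * s x"] by (simp add: mult.commute)
  then have odd': "odd (v (s x))" using assms by (simp add: val_mult)
  have "x + s x \<noteq> 0 \<and> odd (v (x + s x))"
  proof (cases "v x < v (s x)")
    case True
    then show ?thesis using val_add_eq_left[of x "s x"] assms by (simp add: P_iff)
  next
    case False
    then show ?thesis
      using val_add_eq_left[of "s x" x] assms odd' ne by (simp add: P_iff add.commute)
  qed
  then show False using fixed_even[of "x + s x"] by (simp add: add.commute)
qed

lemma val_s [simp]: "v (s x) = v x"
proof (cases "x = 0 \<or> odd (v x)")
  case False
  \<comment> \<open>Multiplying by \<open>\<pi>\<close> changes the parity and so reduces the even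
    case to the odd one.\<close>
  then have "odd (v (x * \<pi>))" using unif_nz val_unif by (simp add: val_mult)
  then have "v (s (x * \<pi>)) = v (x * \<pi>)" using False unif_nz by (intro val_s_odd) auto
  then show ?thesis
    using False unif_nz val_unif val_s_odd[of \<pi>] by (simp add: val_mult)
next
  case True
  then show ?thesis using val_s_odd[of x] by (cases "x = 0") auto
qed

lemma s_P [simp]: "s x \<in> P n \<longleftrightarrow> x \<in> P n"
  by (auto simp: frac_ideal_def)

lemma val_Nm: "x \<noteq> 0 \<Longrightarrow> v (Nm x) = 2 * v x"
  by (simp add: val_mult)

lemma Nm_F: "Nm x \<in> F"
  by (simp add: F_iff mult.commute)

lemma s_unif_ne: "s \<pi> - \<pi> \<noteq> 0"
  using fixed_even[of \<pi>] unif_nz val_unif by auto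

lemma val_s_unif_diff: "v (s \<pi> - \<pi>) = break + 1"
  by (simp add: break_def)

lemma break_nonneg: "0 \<le> break"
  using P_diff[of "s \<pi>" 1 \<pi>] s_unif_ne unif_nz val_unif by (simp add: P_iff break_def)

text \<open>Applying \<open>s\<close> and subtracting forces
  \<open>b = (s x - x) / (s \<pi> - \<pi>)\<close>. Numerator and denominator both change sign under
  \<open>s\<close>, so \<open>b\<close> is fixed.\<close>

lemma F_decomposition:
  obtains a b where "a \<in> F" "b \<in> F" "x = a + b * \<pi>"
proof -
  define b where "b = (s x - x) / (s \<pi> - \<pi>)"
  have eq: "b * (s \<pi> - \<pi>) = s x - x" using s_unif_ne by (simp add: b_def)
  have "s b = (x - s x) / (\<pi> - s \<pi>)" by (simp add: b_def)
  also have "\<dots> = b"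
    by (metis b_def minus_diff_eq minus_divide_divide)
  finally have b: "s b = b" .
  then have "x - b * \<pi> \<in> F" using eq by (simp add: F_iff algebra_simps)
  then show thesis using that[of "x - b * \<pi>" b] b by (simp add: F_iff)
qed

text \<open>Nonzero \<open>a\<close> and \<open>b * \<pi>\<close> have valuations of opposite
  parity, so their leading terms cannot cancel.\<close>

lemma F_decomposition_P:
  assumes a: "a \<in> F" and b: "b \<in> F" and x: "a + b * \<pi> \<in> P n"
  shows "a \<in> P n" "b * \<pi> \<in> P n"
proof -
  have "a \<in> P n \<and> b * \<pi> \<in> P n"
  proof (cases "a = 0 \<or> b = 0")
    case False
    then have "even (v a)" "odd (v (b * \<pi>))"
      using a b fixed_even unif_nz val_unif by (auto simp: F_iff val_mult)
    then have "v a \<noteq> v (b * \<pi>)" by metis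
    then consider "v a < v (b * \<pi>)" | "v (b * \<pi>) < v a" by linarith
    then show ?thesis
    proof cases
      case 1
      then show ?thesis
        using x False unif_nz val_add_eq_left[of a "b * \<pi>"] by (simp add: P_iff)
    next
      case 2
      then show ?thesis
        using x False unif_nz val_add_eq_left[of "b * \<pi>" a] by (simp add: P_iff add.commute)
    qed
  qed (use x in auto)
  then show "a \<in> P n" "b * \<pi> \<in> P n" by auto
qed

text \<open>In \<open>x = a + b * \<pi>\<close> the part \<open>a\<close> cancels, leaving
  \<open>b * (s \<pi> - \<pi>)\<close>.\<close>

lemma s_diff_P:
  assumes "x \<in> P n"
  shows "s x - x \<in> P (n + break)"
proof -
  obtain a b where ab: "a \<in> F" "b \<in> F" "x = a + b * \<pi>" by (rule F_decomposition)
  then have "b * \<pi> \<in> P n" using F_decomposition_P assms by blast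
  then have "b \<in> P (n - 1)"
    using unif_nz val_unif by (cases "b = 0") (auto simp: P_iff val_mult)
  moreover have "s \<pi> - \<pi> \<in> P (break + 1)" using s_unif_ne by (simp add: P_iff val_s_unif_diff)
  ultimately have "b * (s \<pi> - \<pi>) \<in> P (n - 1 + (break + 1))" by (rule P_mult)
  moreover have "s x - x = b * (s \<pi> - \<pi>)"
    using ab by (simp add: F_iff algebra_simps)
  ultimately show ?thesis by simp
qed

text \<open>As \<open>s\<close> negates \<open>s \<pi> - \<pi>\<close>, dividing by this element
  turns the trace into a difference, which \<open>s_diff_P\<close> bounds.\<close>

lemma trace_P:
  assumes "x \<in> P n"
  shows "x + s x \<in> P (n + break)"
proof -
  define z where "z = x / (s \<pi> - \<pi>)"
  have x: "x = z * (s \<pi> - \<pi>)" using s_unif_ne by (simp add: z_def)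
  have "z \<in> P (n - (break + 1))"
    using assms s_unif_ne unfolding z_def
    by (cases "x = 0") (auto simp: P_iff val_divide val_s_unif_diff)
  then have "s z - z \<in> P (n - (break + 1) + break)" by (rule s_diff_P)
  moreover have "s \<pi> - \<pi> \<in> P (break + 1)" using s_unif_ne by (simp add: P_iff val_s_unif_diff)
  ultimately have "(s z - z) * (s \<pi> - \<pi>) \<in> P (n - (break + 1) + break + (break + 1))"
    by (rule P_mult)
  moreover have "x + s x = - ((s z - z) * (s \<pi> - \<pi>))"
    by (simp add: x algebra_simps)
  ultimately show ?thesis using P_minus by fastforce
qed

lemma ram_break_eq: "ram_break s v = break"
proof -
  have iff: "in_ram_group s v i \<longleftrightarrow> i \<le> break" for i
  proof
    assume "in_ram_group s v i"
    then have "i + 1 \<le> v (s \<pi> - \<pi>)"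
      using s_unif_ne val_unif unfolding in_ram_group_def val_ring_def by auto
    then show "i \<le> break" by (simp add: val_s_unif_diff)
  next
    assume i: "i \<le> break"
    show "in_ram_group s v i"
      unfolding in_ram_group_def
    proof (intro ballI impI)
      fix x assume x: "x \<in> val_ring v" "s x \<noteq> x"
      obtain a b where ab: "a \<in> F" "b \<in> F" "x = a + b * \<pi>" by (rule F_decomposition)
      have "x \<in> P 0" using x(1) by (simp add: val_ring_def frac_ideal_def)
      then have "b * \<pi> \<in> P 0" using F_decomposition_P ab by blast
      moreover have b: "b \<noteq> 0" using ab x(2) by (auto simp: F_iff)
      ultimately have "- 1 \<le> v b" using unif_nz val_unif by (simp add: P_iff val_mult)
      moreover have "even (v b)" using b ab(2) fixed_even by (simp add: F_iff)
      \<comment> \<open>For integral \<open>x\<close>, \<open>s_diff_P\<close> alone gives only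
        valuation at least \<open>break\<close>; the parity of \<open>v b\<close> supplies the
        missing one.\<close>
      ultimately have "0 \<le> v b" by presburger
      moreover have "s x - x = b * (s \<pi> - \<pi>)"
        using ab by (simp add: F_iff algebra_simps)
      ultimately show "i + 1 \<le> v (s x - x)"
        using b s_unif_ne i by (simp add: val_mult val_s_unif_diff)
    qed
  qed
  show ?thesis
    unfolding ram_break_def iff by (rule the_equality) auto
qed

section \<open>Unit filtration of the fixed field modulo norms\<close>

abbreviation UF :: "nat \<Rightarrow> 'k set" where "UF \<equiv> unit_filt F (\<lambda>x. v x div 2)"

text \<open>On \<open>F\<close> the normalized valuation is \<open>v div 2\<close>, so level
  \<open>i\<close> of \<open>F\<close> means \<open>2 * i\<close> in \<open>K\<close>. At
  \<open>i = 0\<close> the congruence holds for every unit.\<close>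

lemma UF_eq: "UF i = {x \<in> F. x \<in> units \<and> x - 1 \<in> P (2 * int i)}"
proof (cases i)
  case 0
  have "x - 1 \<in> P 0" if "x \<in> units" for x
    using P_diff[of x 0 1] that by (simp add: P_iff)
  moreover have "v x = 0" if "v x div 2 = 0" "x \<in> F" "x \<noteq> 0" for x
    using that fixed_even[of x] by (auto simp: F_iff elim!: evenE)
  ultimately show ?thesis using 0 by (auto simp: unit_filt_def)
next
  case (Suc n)
  have "x \<in> units" if "x - 1 \<in> P (2 * int i)" for x
    using one_plus_unit[of "x - 1"] P_mono[OF that, of 1] Suc by simp
  moreover have "int i \<le> v (x - 1) div 2 \<longleftrightarrow> 2 * int i \<le> v (x - 1)" for x by presburger
  ultimately show ?thesis using Suc by (auto simp: unit_filt_def P_iff)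
qed

text \<open>Both \<open>u\<close> and \<open>Nm z\<close> lie in \<open>F\<close>, so the odd bound
  suffices by \<open>F_P_even\<close>.\<close>

lemma UF_quotient:
  assumes u: "u \<in> F" "u \<in> units" and z: "z \<in> units" and d: "u - Nm z \<in> P (2 * int i - 1)"
  shows "u / Nm z \<in> UF i"
proof -
  have Nz: "Nm z \<in> units" using z by (simp add: val_mult)
  have "u - Nm z \<in> F" using u Nm_F[of z] by (simp add: F_iff)
  then have "u - Nm z \<in> P (2 * int i)" using d F_P_even by blast
  then show ?thesis
    using unit_quotient[OF u(2) Nz] u(1) Nm_F[of z] by (simp add: UF_eq F_iff)
qed

lemma UF_below_break:
  assumes fin: "finite_residue v" and two: "2 \<in> P 1"
    and u: "u \<in> UF i" and i: "int i < break"
  shows "\<exists>z. z \<noteq> 0 \<and> u / Nm z \<in> UF (Suc i)"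
proof -
  have uF: "u \<in> F" "u \<in> units" and u1: "u - 1 \<in> P (2 * int i)" using u by (auto simp: UF_eq)
  show ?thesis
  proof (cases "i = 0")
    case True
    \<comment> \<open>Since \<open>s\<close> fixes \<open>u ^ n\<close>, its square is its
      norm.\<close>
    obtain n where n: "u - (u ^ n)\<^sup>2 \<in> P 1" using residue_square_root[OF fin two uF(2)] by blast
    have "u ^ n \<in> units" using uF by (simp add: val_power)
    moreover have "u - Nm (u ^ n) \<in> P (2 * int (Suc i) - 1)"
      using n True uF(1) by (simp add: F_iff power2_eq_square)
    ultimately have "u / Nm (u ^ n) \<in> UF (Suc i)" using uF by (intro UF_quotient)
    then show ?thesis using uF by (intro exI[of _ "u ^ n"]) auto
  next
    case i0: False
    show ?thesis
    proof (cases "u - 1 \<in> P (2 * int i + 1)")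
      case True
      have "u / Nm 1 \<in> UF (Suc i)"
        using uF True by (intro UF_quotient) (auto simp: add.commute)
      then show ?thesis by (intro exI[of _ 1]) auto
    next
      case False
      \<comment> \<open>This is the leading coefficient of \<open>u - 1\<close>, a unit of
        \<open>F\<close>. Its approximate square root is a power of \<open>c\<close>, hence again in
        \<open>F\<close>, so the norm of \<open>x\<close> below agrees with \<open>u - 1\<close> to
        leading order.\<close>
      define c where "c = (u - 1) / Nm \<pi> ^ i"
      have "u - 1 \<noteq> 0" using False by auto
      moreover from this have "v (u - 1) = 2 * int i" using False u1 by (simp add: P_iff)
      ultimately have c: "c \<in> units"
        unfolding c_def using unif_nz val_unif by (simp add: val_divide val_power val_mult)
      have cF: "s c = c" using uF(1) unfolding c_def by (simp add: F_iff mult.commute)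
      obtain n where n: "c - (c ^ n)\<^sup>2 \<in> P 1" using residue_square_root[OF fin two c] by blast
      define x where "x = c ^ n * \<pi> ^ i"
      have xP: "x \<in> P (int i)"
        using c unif_nz val_unif by (simp add: x_def P_iff val_mult val_power)
      have Nx: "Nm x = (c ^ n)\<^sup>2 * Nm \<pi> ^ i"
        by (simp add: x_def cF power2_eq_square power_mult_distrib)
      have "Nm \<pi> ^ i \<in> P (2 * int i)"
        using unif_nz val_unif by (simp add: P_iff val_mult val_power)
      then have "(c - (c ^ n)\<^sup>2) * Nm \<pi> ^ i \<in> P (1 + 2 * int i)" using P_mult n by blast
      moreover have "(c - (c ^ n)\<^sup>2) * Nm \<pi> ^ i = (u - 1) - Nm x"
      proof -
        have "c * Nm \<pi> ^ i = u - 1" unfolding c_def using unif_nz by simp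
        then show ?thesis unfolding Nx by (simp only: left_diff_distrib)
      qed
      \<comment> \<open>The trace has valuation at least \<open>i + break\<close>, which is at least
        \<open>2 * i + 1\<close> exactly because \<open>i < break\<close>.\<close>
      moreover have "x + s x \<in> P (1 + 2 * int i)"
        using P_mono[OF trace_P[OF xP]] i by simp
      ultimately have "(u - 1) - Nm x - (x + s x) \<in> P (1 + 2 * int i)" using P_diff by metis
      moreover have "(u - 1) - Nm x - (x + s x) = u - Nm (1 + x)" by (simp add: algebra_simps)
      ultimately have d: "u - Nm (1 + x) \<in> P (2 * int (Suc i) - 1)" by simp
      have z: "1 + x \<in> units" using one_plus_unit P_mono[OF xP, of 1] i0 by simp
      have "u / Nm (1 + x) \<in> UF (Suc i)" using uF z d by (rule UF_quotient)
      then show ?thesis using z by blast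
    qed
  qed
qed

lemma UF_above_break:
  assumes u: "u \<in> UF i" and i: "break < int i"
  shows "\<exists>z. z \<noteq> 0 \<and> u / Nm z \<in> UF (Suc i)"
proof -
  have uF: "u \<in> F" "u \<in> units" and u1: "u - 1 \<in> P (2 * int i)" using u by (auto simp: UF_eq)
  \<comment> \<open>As \<open>s\<close> negates the denominator,
    \<open>\<theta> + s \<theta>\<close> equals
    \<open>(\<pi> - s \<pi>) / (\<pi> - s \<pi>)\<close>.\<close>
  define \<theta> where "\<theta> = \<pi> / (\<pi> - s \<pi>)"
  have nz: "\<pi> - s \<pi> \<noteq> 0" using s_unif_ne by auto
  have val: "v (\<pi> - s \<pi>) = break + 1"
    using val_minus[of "s \<pi> - \<pi>"] val_s_unif_diff by simp
  have \<theta>: "\<theta> \<noteq> 0" "v \<theta> = - break"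
    using nz val unif_nz val_unif by (auto simp: \<theta>_def val_divide)
  have "s \<theta> = - s \<pi> / (\<pi> - s \<pi>)"
    by (simp add: \<theta>_def) (metis minus_diff_eq minus_divide_right)
  then have tr: "\<theta> + s \<theta> = 1"
    using nz by (simp add: \<theta>_def flip: diff_divide_distrib)
  define x where "x = (u - 1) * \<theta>"
  have xP: "x \<in> P (2 * int i - break)"
    using P_mult[OF u1, of \<theta> "- break"] \<theta> by (simp add: x_def P_iff)
  have z: "1 + x \<in> units"
    using one_plus_unit P_mono[OF xP, of 1] i break_nonneg by simp
  have sx: "s x = (u - 1) * s \<theta>" using uF(1) by (simp add: x_def F_iff)
  have "x + s x = (u - 1) * (\<theta> + s \<theta>)" unfolding sx by (simp add: x_def algebra_simps)
  then have "x + s x = u - 1" using tr by simp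
  \<comment> \<open>The trace matches \<open>u - 1\<close> exactly. The remaining error lies in
    \<open>P (4 * i - 2 * break)\<close>, which is deep enough since
    \<open>i \<ge> break + 1\<close>.\<close>
  then have "u - Nm (1 + x) = - Nm x" by (simp add: algebra_simps)
  moreover have "Nm x \<in> P ((2 * int i - break) + (2 * int i - break))"
    using xP by (intro P_mult) auto
  ultimately have d: "u - Nm (1 + x) \<in> P (2 * int (Suc i) - 1)"
    using P_mono P_minus i by simp
  have "u / Nm (1 + x) \<in> UF (Suc i)" using uF z d by (rule UF_quotient)
  then show ?thesis using z by blast
qed

lemma UF_antimono: "i \<le> j \<Longrightarrow> UF j \<subseteq> UF i"
  by (auto simp: UF_eq intro: P_mono)

lemma UF_subset: "UF i \<subseteq> unit_filt UNIV v (2 * i)"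
  by (auto simp: UF_eq unit_filt_UNIV)

text \<open>Writing \<open>x - 1 = a + b * \<pi>\<close>, take \<open>u = 1 + a\<close>: parity
  pushes \<open>b * \<pi>\<close> from level \<open>2 * n\<close> to level
  \<open>2 * n + 1\<close>.\<close>

lemma UF_decomposition:
  assumes n: "0 < n" and x: "x \<in> unit_filt UNIV v (2 * n)"
  obtains u where "u \<in> UF n" "x / u \<in> unit_filt UNIV v (2 * n + 1)"
proof -
  have x': "x \<in> units" "x - 1 \<in> P (2 * int n)" using x by (auto simp: unit_filt_UNIV)
  obtain a b where ab: "a \<in> F" "b \<in> F" "x - 1 = a + b * \<pi>" by (rule F_decomposition)
  then have a: "a \<in> P (2 * int n)" and b: "b * \<pi> \<in> P (2 * int n)"
    using F_decomposition_P x'(2) by metis+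
  have "b \<in> P (2 * int n - 1)"
    using b unif_nz val_unif by (cases "b = 0") (auto simp: P_iff val_mult)
  then have "b \<in> P (2 * int n)" using ab(2) F_P_even by blast
  then have "b * \<pi> \<in> P (2 * int n + 1)"
    using P_mult[of b _ \<pi> 1] unif_nz val_unif by (simp add: P_iff)
  moreover have "x - (1 + a) = b * \<pi>" using ab(3) by (simp add: algebra_simps)
  ultimately have d: "x - (1 + a) \<in> P (2 * int n + 1)" by simp
  have u: "1 + a \<in> units" using one_plus_unit P_mono[OF a, of 1] n by simp
  have "1 + a \<in> UF n" using u a ab(1) by (simp add: UF_eq F_iff)
  moreover have "x / (1 + a) \<in> unit_filt UNIV v (2 * n + 1)"
    using unit_quotient[OF x'(1) u d] by (simp add: unit_filt_UNIV add.commute)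
  ultimately show thesis using that by blast
qed

end

section \<open>The quadratic character and its conductor\<close>

locale norm_residue_character = ramified_quadratic v s \<pi>
  for v :: "'k::field \<Rightarrow> int" and s :: "'k \<Rightarrow> 'k" and \<pi> :: 'k +
  fixes \<omega> :: "'k \<Rightarrow> complex"
  assumes fin: "finite_residue v" and two: "2 \<in> P 1"
    and is_char: "is_char F (\<lambda>x. v x div 2) \<omega>"
    and nontriv: "\<exists>x\<in>F. x \<noteq> 0 \<and> \<omega> x \<noteq> 1"
    and norms: "x \<noteq> 0 \<Longrightarrow> \<omega> (Nm x) = 1"
begin

lemma omega_mult: "x \<in> F \<Longrightarrow> y \<in> F \<Longrightarrow> x \<noteq> 0 \<Longrightarrow> y \<noteq> 0 \<Longrightarrow> \<omega> (x * y) = \<omega> x * \<omega> y"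
  using is_char unfolding is_char_def by blast

lemma omega_quotient_norm:
  assumes "u \<in> F" "u \<noteq> 0" "z \<noteq> 0"
  shows "\<omega> (u / Nm z) = \<omega> u"
proof -
  have "u / Nm z \<in> F" using assms(1) Nm_F[of z] by (simp add: F_iff)
  then have "\<omega> (u / Nm z * Nm z) = \<omega> (u / Nm z) * \<omega> (Nm z)"
    using assms Nm_F[of z] by (intro omega_mult) auto
  then show ?thesis using assms norms by simp
qed

definition trivial_on :: "nat \<Rightarrow> bool" where
  "trivial_on i \<longleftrightarrow> (\<forall>x\<in>UF i. \<omega> x = 1)"

lemma trivial_on_mono: "trivial_on i \<Longrightarrow> i \<le> j \<Longrightarrow> trivial_on j"
  using UF_antimono unfolding trivial_on_def by blast

text \<open>Away from the break, a norm moves \<open>u\<close> one level deeper without changing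
  \<open>\<omega> u\<close>.\<close>

lemma trivial_on_step:
  assumes "trivial_on (Suc i)" "int i \<noteq> break"
  shows "trivial_on i"
  unfolding trivial_on_def
proof
  fix u assume u: "u \<in> UF i"
  then obtain z where z: "z \<noteq> 0" "u / Nm z \<in> UF (Suc i)"
    using assms(2) UF_below_break[OF fin two u] UF_above_break[OF u]
    by (meson linorder_neqE)
  then have "\<omega> (u / Nm z) = 1" using assms(1) by (simp add: trivial_on_def)
  then show "\<omega> u = 1" using omega_quotient_norm[of u z] u z(1) by (simp add: UF_eq)
qed

text \<open>Norms attain every even valuation, so every nonzero element of \<open>F\<close> is a
  unit of \<open>F\<close> times a norm.\<close>

lemma not_trivial_on_0: "\<not> trivial_on 0"
proof
  assume triv: "trivial_on 0"
  obtain x where x: "x \<in> F" "x \<noteq> 0" "\<omega> x \<noteq> 1" using nontriv by blast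
  obtain k where k: "v x = 2 * k" using fixed_even x by (auto simp: F_iff elim: evenE)
  obtain z where z: "z \<noteq> 0" "v z = k"
    using discrete_val unfolding discrete_val_def by blast
  have "x / Nm z \<in> UF 0"
    using x z k Nm_F[of z] P_diff[of "x / Nm z" 0 1]
    by (simp add: UF_eq F_iff val_divide val_mult P_iff)
  then have "\<omega> (x / Nm z) = 1" using triv by (simp add: trivial_on_def)
  then show False using omega_quotient_norm x z by simp
qed

lemma trivial_on_iff: "trivial_on i \<longleftrightarrow> break < int i"
proof
  assume triv: "trivial_on i"
  show "break < int i"
  proof (rule ccontr)
    assume "\<not> break < int i"
    then have "int i \<le> break" by simp
    with triv have "trivial_on 0"
    proof (induction i)
      case (Suc i)
      then show ?case using trivial_on_step[of i] by simp
    qed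
    then show False using not_trivial_on_0 by simp
  qed
next
  assume i: "break < int i"
  obtain j where j: "trivial_on j"
    using is_char unfolding is_char_def trivial_on_def by blast
  \<comment> \<open>Descending from \<open>i + j\<close> to \<open>i\<close> stays above the break
    and never meets the exceptional level.\<close>
  then have "trivial_on (i + j)" using trivial_on_mono by simp
  then show "trivial_on i"
  proof (induction j)
    case (Suc j)
    then show ?case using trivial_on_step[of "i + j"] i by simp
  qed simp
qed

lemma conductor_omega: "int (conductor F (\<lambda>x. v x div 2) \<omega>) = break + 1"
proof -
  have "conductor F (\<lambda>x. v x div 2) \<omega> = (LEAST i. trivial_on i)"
    by (simp add: conductor_def trivial_on_def)
  also have "\<dots> = nat (break + 1)"
    unfolding trivial_on_iff using break_nonneg by (intro Least_equality) auto
  finally show ?thesis using break_nonneg by simp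
qed

section \<open>Conductors of symplectic type characters\<close>

lemma conductor_symplectic:
  assumes char: "is_char UNIV v \<chi>" and res: "\<And>x. x \<in> F \<Longrightarrow> x \<noteq> 0 \<Longrightarrow> \<chi> x = \<omega> x"
  defines "m \<equiv> conductor UNIV v \<chi>"
  shows "2 * break + 1 \<le> int m" "odd m \<Longrightarrow> int m = 2 * break + 1"
proof -
  define triv where "triv i \<longleftrightarrow> (\<forall>x\<in>unit_filt UNIV v i. \<chi> x = 1)" for i
  have "\<exists>i. triv i" using char by (simp add: is_char_def triv_def)
  then have m: "triv m"
    unfolding m_def conductor_def triv_def by (rule LeastI_ex)
  have least: "m \<le> i" if "triv i" for i
    using that unfolding m_def conductor_def triv_def by (rule Least_le)
  have "trivial_on i" if "m \<le> 2 * i" for i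
    unfolding trivial_on_def
  proof
    fix u assume u: "u \<in> UF i"
    then have "u \<in> unit_filt UNIV v m"
      using UF_subset[of i] that by (auto simp: unit_filt_UNIV intro: P_mono)
    then show "\<omega> u = 1" using m res[of u] u by (simp add: triv_def UF_eq)
  qed
  \<comment> \<open>If \<open>m \<le> 2 * break\<close>, then \<open>\<omega>\<close> would be
    trivial at the break level.\<close>
  from this[of "nat break"] show ge: "2 * break + 1 \<le> int m"
    using trivial_on_iff[of "nat break"] break_nonneg by linarith
  assume "odd m"
  then obtain n where n: "m = 2 * n + 1" by (rule oddE)
  show "int m = 2 * break + 1"
  proof (rule ccontr)
    assume "int m \<noteq> 2 * break + 1"
    then have gt: "break < int n" using ge n by simp
    then have n0: "0 < n" using break_nonneg by linarith
    \<comment> \<open>Beyond the break \<open>\<chi>\<close> is trivial on \<open>UF n\<close>, so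
      triviality spreads from level \<open>2 * n + 1\<close> to level \<open>2 * n\<close>, against
      the minimality of \<open>m\<close>.\<close>
    have "triv (2 * n)"
      unfolding triv_def
    proof
      fix x assume "x \<in> unit_filt UNIV v (2 * n)"
      then obtain u where u: "u \<in> UF n" "x / u \<in> unit_filt UNIV v (2 * n + 1)"
        using UF_decomposition[OF n0] by blast
      have nz: "u \<noteq> 0" "x / u \<noteq> 0" using u by (auto simp: UF_eq unit_filt_UNIV)
      have "\<chi> (x / u * u) = \<chi> (x / u) * \<chi> u"
        using char nz unfolding is_char_def by blast
      moreover have "\<chi> (x / u) = 1" using m u(2) n by (simp add: triv_def)
      moreover have "\<chi> u = 1"
        using trivial_on_iff[of n] gt u(1) res[of u] by (auto simp: trivial_on_def UF_eq)
      ultimately show "\<chi> x = 1" using nz by simp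
    qed
    then show False using least n by fastforce
  qed
qed

end

theorem theorem1p1:
  fixes vK :: "'k::field_char_0 \<Rightarrow> int" and s :: "'k \<Rightarrow> 'k" and \<omega> :: "'k \<Rightarrow> complex"
  assumes K_local: "local_field vK"
    and s_aut: "field_aut s" and s_invol: "s \<circ> s = id" and s_nontriv: "s \<noteq> id"
    and res_char_2: "1 \<le> vK 2"
    and ramified: "\<forall>x. x \<noteq> 0 \<and> s x = x \<longrightarrow> even (vK x)"
    and \<omega>_char: "is_char (fixed_field s) (\<lambda>x. vK x div 2) \<omega>"
    and \<omega>_nontriv: "\<exists>x\<in>fixed_field s. x \<noteq> 0 \<and> \<omega> x \<noteq> 1"
    and \<omega>_norms: "\<forall>x. x \<noteq> 0 \<longrightarrow> \<omega> (x * s x) = 1"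
  shows "int (conductor (fixed_field s) (\<lambda>x. vK x div 2) \<omega>) = ram_break s vK + 1 \<and>
    (\<forall>\<chi>. is_char UNIV vK \<chi> \<and> (\<forall>x\<in>fixed_field s. x \<noteq> 0 \<longrightarrow> \<chi> x = \<omega> x) \<longrightarrow>
       (odd (conductor UNIV vK \<chi>) \<longrightarrow> int (conductor UNIV vK \<chi>) = 2 * ram_break s vK + 1) \<and>
       (even (conductor UNIV vK \<chi>) \<longrightarrow> 2 * (ram_break s vK + 1) \<le> int (conductor UNIV vK \<chi>)))"
proof -
  have val: "discrete_val vK" and fin: "finite_residue vK"
    using K_local by (auto simp: local_field_def)
  obtain \<pi> where \<pi>: "\<pi> \<noteq> 0" "vK \<pi> = 1"
    using val unfolding discrete_val_def by blast
  interpret norm_residue_character vK s \<pi> \<omega>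
  proof unfold_locales
    show "s (s x) = x" for x using s_invol by (metis comp_apply id_apply)
    show "2 \<in> frac_ideal vK 1" using res_char_2 by (simp add: frac_ideal_def)
  qed (use assms val fin \<pi> in auto)
  show ?thesis
    unfolding ram_break_eq
  proof (intro conjI allI impI conductor_omega)
    fix \<chi> assume "is_char UNIV vK \<chi> \<and> (\<forall>x\<in>fixed_field s. x \<noteq> 0 \<longrightarrow> \<chi> x = \<omega> x)"
    then have \<chi>: "is_char UNIV vK \<chi>" "\<And>x. x \<in> fixed_field s \<Longrightarrow> x \<noteq> 0 \<Longrightarrow> \<chi> x = \<omega> x" by auto
    note cond = conductor_symplectic[OF \<chi>]
    show "int (conductor UNIV vK \<chi>) = 2 * break + 1" if "odd (conductor UNIV vK \<chi>)"
      using cond(2) that by blast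
    show "2 * (break + 1) \<le> int (conductor UNIV vK \<chi>)" if "even (conductor UNIV vK \<chi>)"
    proof -
      \<comment> \<open>Parity excludes equality in the lower bound, which raises it by one.\<close>
      have "int (conductor UNIV vK \<chi>) \<noteq> 2 * break + 1"
        using that by (metis even_of_nat even_mult_iff even_plus_one_iff even_numeral)
      then show ?thesis using cond(1) by simp
    qed
  qed
qed

end
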